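(* Consider the networked system $x(t+1)=(A+BQC)x(t)+BRu(t)$, $y(t)=SCx(t)$ described in the context with $S=I$. Let $r\ge 2n-1$ be an integer and let $M_i:=C(A+BQC)^iBR$, $i=0,1,\dots,r$, be the Markov parameters of the system. Let $K_\ell:=M_\ell-CA^\ell BR$ for $\ell=1,\dots,r$, let $K$ be the matrix obtained by stacking $K_1,K_2,\dots,K_r$ on top of each other, and for $i=0,\dots,r-1$ let $L_i$ denote the $(i+1)$-th column block of the block Toeplitz matrix $$L:=\begin{pmatrix}CB&0&\cdots&0\\ CAB&CB&\cdots&0\\ \vdots&\vdots&\ddots&\vdots\\ CA^{r-1}B&CA^{r-2}B&\cdots&CB\end{pmatrix}.$$ If the topology of the system is identifiable, then the interconnection matrix $Q$ is the unique solution to the generalized Sylvester equation $$K=\sum_{i=0}^{r-1}L_i\,\mathbf Q\,M_i$$ in the unknown real matrix $\mathbf Q$.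
   Context: Network model. Let $N\ge 1$. For $i\in\mathcal V:=\{1,2,\dots,N\}$, let $A_i\in\mathbb R^{n_i\times n_i}$, $B_i\in\mathbb R^{n_i\times m_i}$, $C_i\in\mathbb R^{p_i\times n_i}$ define the discrete-time node system $x_i(t+1)=A_ix_i(t)+B_iv_i(t)$, $w_i(t)=C_ix_i(t)$. The nodes are coupled by $v_i(t)=\sum_{j=1}^N Q_{ij}w_j(t)+R_iu(t)$ with external input $u(t)\in\mathbb R^m$, and the external output is $y(t)=\sum_{i=1}^N S_iw_i(t)\in\mathbb R^p$, where $Q_{ij}\in\mathbb R^{m_i\times p_j}$, $R_i\in\mathbb R^{m_i\times m}$, $S_i\in\mathbb R^{p\times p_i}$. Let $A,B,C$ be the block diagonal matrices with diagonal blocks $A_i$, $B_i$, $C_i$ ($i=1,\dots,N$), respectively; let $Q=(Q_{ij})$ be the block matrix with blocks $Q_{ij}$ (the interconnection matrix), let $R$ be the matrix obtained by stacking $R_1,\dots,R_N$ on top of each other, and $S=\begin{pmatrix}S_1&\cdots&S_N\end{pmatrix}$. With $n=\sum_i n_i$ and $x(t)\in\mathbb R^n$ the stacked state, the network is $x(t+1)=(A+BQC)x(t)+BRu(t)$, $y(t)=SCx(t)$, $t=0,1,2,\dots$. The matrices $A,B,C,R,S$ are fixed and known. Identifiability. Let $y_{u,x_0,Q}(\cdot)$ denote the output of the network for input $u(\cdot)$, initial condition $x(0)=x_0$ and interconnection matrix $Q$. Two real interconnection matrices $Q,\bar Q$ (of the same size) are indistinguishable if there exist $x_0,\bar x_0\in\mathbb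 R^n$ such that $y_{u,x_0,Q}(\cdot)=y_{u,\bar x_0,\bar Q}(\cdot)$ for all input functions $u$; otherwise they are distinguishable. The topology of the network with interconnection matrix $Q$ is identifiable if $Q$ and $\bar Q$ are distinguishable for all real $\bar Q\neq Q$. *)

theory Defs
  imports "Jordan_Normal_Form.Matrix"
begin

(* The extra argument is the column (row) count of the empty stack (row), which the
   list of blocks alone does not determine. *)
definition vstack :: "nat \<Rightarrow> real mat list \<Rightarrow> real mat" where
  "vstack nc Xs = foldr append_rows Xs (0\<^sub>m 0 nc)"

definition append_cols :: "real mat \<Rightarrow> real mat \<Rightarrow> real mat" where
  "append_cols X Y = four_block_mat X Y (0\<^sub>m 0 (dim_col X)) (0\<^sub>m 0 (dim_col Y))"

definition hstack :: "nat \<Rightarrow> real mat list \<Rightarrow> real mat" where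
  "hstack nr Xs = foldr append_cols Xs (0\<^sub>m nr 0)"

lemma vstack_carrier:
  "(\<And>X. X \<in> set Xs \<Longrightarrow> dim_col X = nc) \<Longrightarrow>
    vstack nc Xs \<in> carrier_mat (\<Sum>X\<leftarrow>Xs. dim_row X) nc"
  by (induction Xs) (auto simp: vstack_def append_rows_def)

lemma hstack_carrier:
  "(\<And>X. X \<in> set Xs \<Longrightarrow> dim_row X = nr) \<Longrightarrow>
    hstack nr Xs \<in> carrier_mat nr (\<Sum>X\<leftarrow>Xs. dim_col X)"
  by (induction Xs) (auto simp: hstack_def append_cols_def)

(* Column block i (counted from 0) of X, all column blocks having width w. *)
definition column_block :: "nat \<Rightarrow> real mat \<Rightarrow> nat \<Rightarrow> real mat" where
  "column_block w X i = mat (dim_row X) w (\<lambda>(a, b). X $$ (a, i * w + b))"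

(* The sum of F i over i < k; matrices of varying size form no additive monoid type,
   so the size is an argument. *)
definition mat_sum :: "nat \<Rightarrow> nat \<Rightarrow> (nat \<Rightarrow> real mat) \<Rightarrow> nat \<Rightarrow> real mat" where
  "mat_sum nr nc F k = mat nr nc (\<lambda>(a, b). \<Sum>i<k. F i $$ (a, b))"

primrec network_state ::
  "real mat \<Rightarrow> real mat \<Rightarrow> real mat \<Rightarrow> real mat \<Rightarrow> real mat \<Rightarrow>
    (nat \<Rightarrow> real vec) \<Rightarrow> real vec \<Rightarrow> nat \<Rightarrow> real vec" where
  "network_state A B C R Q u x0 0 = x0"
| "network_state A B C R Q u x0 (Suc t) =
    (A + B * Q * C) *\<^sub>v network_state A B C R Q u x0 t + (B * R) *\<^sub>v u t"

definition network_output ::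
  "real mat \<Rightarrow> real mat \<Rightarrow> real mat \<Rightarrow> real mat \<Rightarrow> real mat \<Rightarrow> real mat \<Rightarrow>
    (nat \<Rightarrow> real vec) \<Rightarrow> real vec \<Rightarrow> nat \<Rightarrow> real vec" where
  "network_output A B C R S Q u x0 t = (S * C) *\<^sub>v network_state A B C R Q u x0 t"

definition indistinguishable ::
  "real mat \<Rightarrow> real mat \<Rightarrow> real mat \<Rightarrow> real mat \<Rightarrow> real mat \<Rightarrow> real mat \<Rightarrow> real mat \<Rightarrow> bool" where
  "indistinguishable A B C R S Q Q' \<longleftrightarrow>
    (\<exists>x0 \<in> carrier_vec (dim_row A). \<exists>x0' \<in> carrier_vec (dim_row A).
      \<forall>u. (\<forall>t. u t \<in> carrier_vec (dim_col R)) \<longrightarrow>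
        network_output A B C R S Q u x0 = network_output A B C R S Q' u x0')"

definition identifiable ::
  "real mat \<Rightarrow> real mat \<Rightarrow> real mat \<Rightarrow> real mat \<Rightarrow> real mat \<Rightarrow> real mat \<Rightarrow> bool" where
  "identifiable A B C R S Q \<longleftrightarrow>
    (\<forall>Q' \<in> carrier_mat (dim_row Q) (dim_col Q). Q' \<noteq> Q \<longrightarrow>
      \<not> indistinguishable A B C R S Q Q')"

definition markov ::
  "real mat \<Rightarrow> real mat \<Rightarrow> real mat \<Rightarrow> real mat \<Rightarrow> real mat \<Rightarrow> nat \<Rightarrow> real mat" where
  "markov A B C R Q i = C * (A + B * Q * C) ^\<^sub>m i * B * R"

definition K_block ::
  "real mat \<Rightarrow> real mat \<Rightarrow> real mat \<Rightarrow> real mat \<Rightarrow> real mat \<Rightarrow> nat \<Rightarrow> real mat" where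
  "K_block A B C R Q l = markov A B C R Q l - C * A ^\<^sub>m l * B * R"

definition K_mat ::
  "real mat \<Rightarrow> real mat \<Rightarrow> real mat \<Rightarrow> real mat \<Rightarrow> real mat \<Rightarrow> nat \<Rightarrow> real mat" where
  "K_mat A B C R Q r = vstack (dim_col R) (map (K_block A B C R Q) [1..<Suc r])"

definition L_mat :: "real mat \<Rightarrow> real mat \<Rightarrow> real mat \<Rightarrow> nat \<Rightarrow> real mat" where
  "L_mat A B C r =
    vstack (r * dim_col B)
      (map (\<lambda>k. hstack (dim_row C)
        (map (\<lambda>i. if i \<le> k then C * A ^\<^sub>m (k - i) * B else 0\<^sub>m (dim_row C) (dim_col B))
          [0..<r])) [0..<r])"

definition L_block :: "real mat \<Rightarrow> real mat \<Rightarrow> real mat \<Rightarrow> nat \<Rightarrow> nat \<Rightarrow> real mat" where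
  "L_block A B C r i = column_block (dim_col B) (L_mat A B C r) i"

(* X solves the generalized Sylvester equation determined by the network with
   interconnection matrix Q; Q enters only through the Markov parameters. *)
definition sylvester_solution ::
  "real mat \<Rightarrow> real mat \<Rightarrow> real mat \<Rightarrow> real mat \<Rightarrow> real mat \<Rightarrow> nat \<Rightarrow> real mat \<Rightarrow> bool" where
  "sylvester_solution A B C R Q r X \<longleftrightarrow>
    K_mat A B C R Q r =
      mat_sum (r * dim_row C) (dim_col R) (\<lambda>i. L_block A B C r i * X * markov A B C R Q i) r"

end

theory Submission
  imports Defs "Jordan_Normal_Form.Determinant"
begin

text \<open>
  Write \<open>F Q = A + B Q C\<close> and \<open>M\<^sub>k Q = C (F Q)\<^sup>k B R\<close>. Expanding \<open>(F Q)\<^sup>k\<close> as a perturbation of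
  \<open>A\<^sup>k\<close> gives \<open>M\<^sub>k Q = C A\<^sup>k B R + (\<Sum>i<k. C A\<^bsup>k-1-i\<^esup> B Q M\<^sub>i Q)\<close> (\<open>markov_recursion\<close>). For
  \<open>k = 1, \<dots>, r\<close> these identities are exactly the block rows of the Sylvester equation
  (\<open>sylvester_solution_iff_recursion\<close>), so \<open>Q\<close> is a solution.

  Conversely let \<open>X\<close> be a solution. Then the Markov parameters of \<open>Q\<close> satisfy, up to index \<open>r\<close>, the
  recursion that generates those of \<open>X\<close>, and induction gives \<open>M\<^sub>k X = M\<^sub>k Q\<close> for \<open>k \<le> r\<close>
  (\<open>markov_eq_if_recursion\<close>). Both sequences come from state spaces of dimension \<open>n\<close>, so they
  satisfy, column by column, a common linear recurrence of order at most \<open>2n\<close>. Since \<open>r + 1 \<ge> 2n\<close>,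
  they agree everywhere (\<open>markov_parameters_determined\<close>). From the initial state \<open>0\<close> the output is
  a function of the input and the Markov parameters only, so \<open>Q\<close> and \<open>X\<close> are indistinguishable
  (\<open>indistinguishable_if_markov_eq\<close>), and identifiability forces \<open>X = Q\<close>.

  The coefficients of the recurrence are those of a linear dependence between \<open>2n + 1\<close> vectors of
  length \<open>2n\<close>; it exists because a square matrix with a zero row is singular
  (\<open>nontrivial_combination\<close>).
\<close>

section \<open>Associativity, distributivity and powers with dimension side conditions\<close>

text \<open>Side conditions on \<^const>\<open>dim_row\<close> and \<^const>\<open>dim_col\<close> can be decided by rewriting, so in this
  form the laws can be used as rewrite rules for long products whose factors have different
  shapes.\<close>

lemma mult_assoc_dim:
  fixes X Y Z :: "'a :: semiring_0 mat"
  assumes "dim_col X = dim_row Y" "dim_col Y = dim_row Z"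
  shows "X * Y * Z = X * (Y * Z)"
  using assms by (intro assoc_mult_mat) auto

lemma mult_add_distrib_dim:
  fixes X Y Z :: "'a :: semiring_0 mat"
  assumes "dim_col X = dim_row Y" "dim_row Z = dim_row Y" "dim_col Z = dim_col Y"
  shows "X * (Y + Z) = X * Y + X * Z"
  using assms by (intro mult_add_distrib_mat) auto

lemma add_mult_distrib_dim:
  fixes X Y Z :: "'a :: semiring_0 mat"
  assumes "dim_col X = dim_row Z" "dim_row X = dim_row Y" "dim_col X = dim_col Y"
  shows "(X + Y) * Z = X * Z + Y * Z"
  using assms by (intro add_mult_distrib_mat) auto

lemma mult_mat_index:
  assumes "X \<in> carrier_mat p m" "Y \<in> carrier_mat m q" "a < p" "b < q"
  shows "(X * Y) $$ (a, b) = (\<Sum>c<m. X $$ (a, c) * Y $$ (c, b))"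
  using assms by (auto simp: scalar_prod_def atLeast0LessThan)

lemma pow_mat_add:
  fixes F :: "'a :: semiring_1 mat"
  assumes "F \<in> carrier_mat n n"
  shows "F ^\<^sub>m (j + k) = F ^\<^sub>m j * F ^\<^sub>m k"
proof (induction k)
  case 0
  then show ?case using assms by simp
next
  case (Suc k)
  then show ?case using assms by (simp add: mult_assoc_dim)
qed

section \<open>Finitely many Markov parameters determine all of them\<close>

text \<open>More unknowns than equations: padding the \<open>N\<close> equations with a zero row gives a singular
  square system.\<close>

lemma nontrivial_combination:
  fixes z :: "nat \<Rightarrow> nat \<Rightarrow> 'a :: idom"
  obtains v j where "j \<le> N" "v j \<noteq> 0" "\<And>a. a < N \<Longrightarrow> (\<Sum>i\<le>N. v i * z i a) = 0"
proof -
  let ?n = "Suc N"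
  define Z where "Z = mat\<^sub>r ?n ?n (\<lambda>a. if a = N then 0\<^sub>v ?n else vec ?n (\<lambda>i. z i a))"
  have Z: "Z \<in> carrier_mat ?n ?n"
    by (simp add: Z_def)
  have "det Z = 0"
    unfolding Z_def by (rule det_row_0) auto
  then obtain v where v: "v \<in> carrier_vec ?n" "v \<noteq> 0\<^sub>v ?n" "Z *\<^sub>v v = 0\<^sub>v ?n"
    using det_0_iff_vec_prod_zero[OF Z] by blast
  obtain j where j: "j < ?n" "v $ j \<noteq> 0"
  proof (rule ccontr)
    assume "\<not> thesis"
    then have "v = 0\<^sub>v ?n"
      using that v(1) by (intro eq_vecI) auto
    then show False using v(2) by simp
  qed
  have "(\<Sum>i\<le>N. v $ i * z i a) = 0" if a: "a < N" for a
  proof -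
    have "0 = (Z *\<^sub>v v) $ a"
      using v(3) a by simp
    also have "\<dots> = (\<Sum>i = 0..<?n. z i a * v $ i)"
      using a v(1) Z by (simp add: scalar_prod_def Z_def row_def)
    also have "\<dots> = (\<Sum>i\<le>N. v $ i * z i a)"
      by (simp add: atLeast0LessThan lessThan_Suc_atMost mult.commute)
    finally show ?thesis by simp
  qed
  then show ?thesis
    using that[of j "\<lambda>i. v $ i"] j by simp
qed

text \<open>The last nonzero coefficient, of some index \<open>l \<le> N\<close>, turns the relation into a recurrence that
  determines \<open>d k\<close> from the \<open>l\<close> terms before it, so vanishing propagates from the first \<open>N\<close> terms to
  the whole sequence.\<close>

lemma recurrence_eq_zero:
  fixes d v :: "nat \<Rightarrow> 'a :: idom"
  assumes rec: "\<And>k. (\<Sum>i\<le>N. v i * d (k + i)) = 0"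
    and nz: "j \<le> N" "v j \<noteq> 0"
    and init: "\<And>k. k < N \<Longrightarrow> d k = 0"
  shows "d k = 0"
proof -
  define l where "l = (GREATEST j. j \<le> N \<and> v j \<noteq> 0)"
  have l: "l \<le> N" "v l \<noteq> 0"
    using GreatestI_nat[of "\<lambda>j. j \<le> N \<and> v j \<noteq> 0" j N] nz by (auto simp: l_def)
  have above: "v i = 0" if "i \<le> N" "i > l" for i
    using Greatest_le_nat[of "\<lambda>j. j \<le> N \<and> v j \<noteq> 0" i N] that by (force simp: l_def)
  show ?thesis
  proof (induction k rule: less_induct)
    case (less k)
    show ?case
    proof (cases "k < l")
      case True
      then show ?thesis using init l(1) by simp
    next
      case False
      have "v i * d (k - l + i) = 0" if "i \<le> N" "i \<noteq> l" for i
      proof (cases "i < l")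
        case True
        then show ?thesis using less[of "k - l + i"] False by simp
      next
        case False
        then show ?thesis using above that by simp
      qed
      then have "(\<Sum>i\<le>N. v i * d (k - l + i)) = (\<Sum>i\<in>{l}. v i * d (k - l + i))"
        using l(1) by (intro sum.mono_neutral_right) auto
      then have "v l * d k = 0"
        using rec[of "k - l"] False by simp
      then show ?thesis using l(2) by simp
    qed
  qed
qed

text \<open>A linear relation between the vectors \<open>F ^ i G e\<^sub>b\<close> is inherited, with every shift \<open>k\<close>, by
  the scalars \<open>e\<^sub>a C F ^ (k + i) G e\<^sub>b\<close>, because \<open>C F ^ k\<close> acts linearly from the left.\<close>

lemma markov_entry_recurrence:
  fixes C F G :: "'a :: comm_semiring_1 mat"
  assumes C: "C \<in> carrier_mat p n" and F: "F \<in> carrier_mat n n" and G: "G \<in> carrier_mat n q"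
    and ab: "a < p" "b < q"
    and rel: "\<And>e. e < n \<Longrightarrow> (\<Sum>i\<le>N. v i * (F ^\<^sub>m i * G) $$ (e, b)) = 0"
  shows "(\<Sum>i\<le>N. v i * (C * F ^\<^sub>m (k + i) * G) $$ (a, b)) = 0"
proof -
  have entry: "(C * F ^\<^sub>m (k + i) * G) $$ (a, b) =
      (\<Sum>e<n. (C * F ^\<^sub>m k) $$ (a, e) * (F ^\<^sub>m i * G) $$ (e, b))" for i
  proof -
    have "C * F ^\<^sub>m (k + i) * G = (C * F ^\<^sub>m k) * (F ^\<^sub>m i * G)"
      using C F G by (simp add: pow_mat_add[OF F] mult_assoc_dim)
    also have "\<dots> $$ (a, b) = (\<Sum>e<n. (C * F ^\<^sub>m k) $$ (a, e) * (F ^\<^sub>m i * G) $$ (e, b))"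
      using C F G ab by (intro mult_mat_index) auto
    finally show ?thesis .
  qed
  have "(\<Sum>i\<le>N. v i * (C * F ^\<^sub>m (k + i) * G) $$ (a, b)) =
      (\<Sum>i\<le>N. \<Sum>e<n. (C * F ^\<^sub>m k) $$ (a, e) * (v i * (F ^\<^sub>m i * G) $$ (e, b)))"
    by (simp only: entry sum_distrib_left mult.left_commute)
  also have "\<dots> = (\<Sum>e<n. (C * F ^\<^sub>m k) $$ (a, e) * (\<Sum>i\<le>N. v i * (F ^\<^sub>m i * G) $$ (e, b)))"
    by (subst sum.swap) (simp only: sum_distrib_left)
  also have "\<dots> = 0"
    by (rule sum.neutral) (simp add: rel)
  finally show ?thesis .
qed

text \<open>Stack the states of both realizations into vectors of length \<open>n1 + n2\<close>. The
  \<open>n1 + n2 + 1\<close> stacked vectors generated by a fixed input column satisfy a nontrivial linear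
  relation, and this one relation is a recurrence for both sequences of Markov parameters, hence
  for their difference.\<close>

lemma markov_parameters_determined:
  fixes F1 F2 :: "'a :: idom mat"
  assumes 1: "C1 \<in> carrier_mat p n1" "F1 \<in> carrier_mat n1 n1" "G1 \<in> carrier_mat n1 q"
    and 2: "C2 \<in> carrier_mat p n2" "F2 \<in> carrier_mat n2 n2" "G2 \<in> carrier_mat n2 q"
    and init: "\<And>k. k < n1 + n2 \<Longrightarrow> C1 * F1 ^\<^sub>m k * G1 = C2 * F2 ^\<^sub>m k * G2"
  shows "C1 * F1 ^\<^sub>m k * G1 = C2 * F2 ^\<^sub>m k * G2"
proof (rule eq_matI)
  fix a b
  assume "a < dim_row (C2 * F2 ^\<^sub>m k * G2)" "b < dim_col (C2 * F2 ^\<^sub>m k * G2)"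
  then have ab: "a < p" "b < q" using 2 by auto
  \<comment> \<open>column \<open>b\<close> of the states of both realizations at time \<open>i\<close>, one on top of the other\<close>
  define z where "z i e = (if e < n1 then (F1 ^\<^sub>m i * G1) $$ (e, b)
    else (F2 ^\<^sub>m i * G2) $$ (e - n1, b))" for i e
  obtain v j where v: "j \<le> n1 + n2" "v j \<noteq> 0"
    "\<And>e. e < n1 + n2 \<Longrightarrow> (\<Sum>i\<le>n1 + n2. v i * z i e) = 0"
    using nontrivial_combination[of "n1 + n2" z] by blast
  have rel1: "(\<Sum>i\<le>n1 + n2. v i * (F1 ^\<^sub>m i * G1) $$ (e, b)) = 0" if "e < n1" for e
    using v(3)[of e] that by (simp add: z_def)
  have rel2: "(\<Sum>i\<le>n1 + n2. v i * (F2 ^\<^sub>m i * G2) $$ (e, b)) = 0" if "e < n2" for e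
    using v(3)[of "n1 + e"] that by (simp add: z_def)
  define d where "d k = (C1 * F1 ^\<^sub>m k * G1) $$ (a, b) - (C2 * F2 ^\<^sub>m k * G2) $$ (a, b)" for k
  have "d k = 0"
  proof (rule recurrence_eq_zero[where d = d and v = v and N = "n1 + n2", OF _ v(1,2)])
    show "(\<Sum>i\<le>n1 + n2. v i * d (k + i)) = 0" for k
      using markov_entry_recurrence[OF 1 ab rel1, where k = k]
        markov_entry_recurrence[OF 2 ab rel2, where k = k]
      by (simp add: d_def right_diff_distrib sum_subtractf)
  qed (simp add: d_def init)
  then show "(C1 * F1 ^\<^sub>m k * G1) $$ (a, b) = (C2 * F2 ^\<^sub>m k * G2) $$ (a, b)"
    by (simp add: d_def)
qed (use 1 2 in auto)

section \<open>Equal Markov parameters are indistinguishable\<close>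

text \<open>Both systems are started in the state \<open>0\<close>, which leaves no free response to compare.
  Comparing \<open>C F ^ k x(t)\<close> for all \<open>k\<close> at once makes the induction on \<open>t\<close> close: the next
  state contributes the value for \<open>k + 1\<close> at time \<open>t\<close> and a Markov parameter applied to \<open>u(t)\<close>.\<close>

lemma indistinguishable_if_markov_eq:
  assumes A: "A \<in> carrier_mat n n" and B: "B \<in> carrier_mat n m" and C: "C \<in> carrier_mat p n"
    and R: "R \<in> carrier_mat m q" and Q: "Q \<in> carrier_mat m p" "Q' \<in> carrier_mat m p"
    and S: "S \<in> carrier_mat s p"
    and eq: "\<And>k. markov A B C R Q k = markov A B C R Q' k"
  shows "indistinguishable A B C R S Q Q'"
proof -
  let ?F = "\<lambda>Q. A + B * Q * C"
  let ?x = "\<lambda>Q u. network_state A B C R Q u (0\<^sub>v n)"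
  note dims = A B C R S
  have x: "?x Q u t \<in> carrier_vec n"
    if "Q \<in> carrier_mat m p" "\<forall>t. u t \<in> carrier_vec q" for Q u t
  proof (induction t)
    case (Suc t)
    have "A + B * Q * C \<in> carrier_mat n n" "B * R \<in> carrier_mat n q" using that dims by auto
    then show ?case using Suc that by (simp del: assoc_mult_mat_vec assoc_mult_mat)
  qed simp
  have step: "(C * ?F Q ^\<^sub>m k) *\<^sub>v ?x Q u (Suc t) =
      (C * ?F Q ^\<^sub>m Suc k) *\<^sub>v ?x Q u t + markov A B C R Q k *\<^sub>v u t"
    if Q: "Q \<in> carrier_mat m p" and u: "\<forall>t. u t \<in> carrier_vec q" for Q u t k
  proof -
    have F: "?F Q \<in> carrier_mat n n" using dims Q by auto
    have CF: "C * ?F Q ^\<^sub>m k \<in> carrier_mat p n" using C F by auto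
    have BR: "B * R \<in> carrier_mat n q" using dims by auto
    have ut: "u t \<in> carrier_vec q" using u by simp
    have "(C * ?F Q ^\<^sub>m k) *\<^sub>v ?x Q u (Suc t) =
        (C * ?F Q ^\<^sub>m k) *\<^sub>v (?F Q *\<^sub>v ?x Q u t) + (C * ?F Q ^\<^sub>m k) *\<^sub>v (B * R *\<^sub>v u t)"
      unfolding network_state.simps
      by (rule mult_add_distrib_mat_vec[OF CF]) (use F BR x[OF Q u] ut in auto)
    also have "(C * ?F Q ^\<^sub>m k) *\<^sub>v (?F Q *\<^sub>v ?x Q u t) = (C * ?F Q ^\<^sub>m k * ?F Q) *\<^sub>v ?x Q u t"
      by (rule assoc_mult_mat_vec[symmetric, OF CF F x[OF Q u]])
    also have "C * ?F Q ^\<^sub>m k * ?F Q = C * ?F Q ^\<^sub>m Suc k"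
      using dims Q by (simp add: mult_assoc_dim)
    also have "(C * ?F Q ^\<^sub>m k) *\<^sub>v (B * R *\<^sub>v u t) = (C * ?F Q ^\<^sub>m k * (B * R)) *\<^sub>v u t"
      by (rule assoc_mult_mat_vec[symmetric, OF CF BR ut])
    also have "C * ?F Q ^\<^sub>m k * (B * R) = markov A B C R Q k"
      unfolding markov_def using CF B R by (simp add: mult_assoc_dim)
    finally show ?thesis .
  qed
  have states: "(C * ?F Q ^\<^sub>m k) *\<^sub>v ?x Q u t = (C * ?F Q' ^\<^sub>m k) *\<^sub>v ?x Q' u t"
    if u: "\<forall>t. u t \<in> carrier_vec q" for u t k
  proof (induction t arbitrary: k)
    case 0
    have "?F Q \<in> carrier_mat n n" "?F Q' \<in> carrier_mat n n" using dims Q by auto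
    then have "C * ?F Q ^\<^sub>m k \<in> carrier_mat p n" "C * ?F Q' ^\<^sub>m k \<in> carrier_mat p n"
      using C by auto
    then show ?case by (auto intro!: eq_vecI simp del: index_mult_mat)
  next
    case (Suc t)
    show ?case
      unfolding step[OF Q(1) u] step[OF Q(2) u] eq Suc.IH ..
  qed
  have "network_output A B C R S Q u (0\<^sub>v n) = network_output A B C R S Q' u (0\<^sub>v n)"
    if u: "\<forall>t. u t \<in> carrier_vec (dim_col R)" for u
  proof
    fix t
    have u': "\<forall>t. u t \<in> carrier_vec q" using u R by auto
    have out: "network_output A B C R S Q u (0\<^sub>v n) t = S *\<^sub>v ((C * ?F Q ^\<^sub>m 0) *\<^sub>v ?x Q u t)"
      if "Q \<in> carrier_mat m p" for Q
      using that dims x[OF that u', of t] assoc_mult_mat_vec[OF S C x[OF that u', of t]]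
      by (simp add: network_output_def)
    show "network_output A B C R S Q u (0\<^sub>v n) t = network_output A B C R S Q' u (0\<^sub>v n) t"
      unfolding out[OF Q(1)] out[OF Q(2)] states[OF u'] ..
  qed
  then show ?thesis
    unfolding indistinguishable_def using A by (intro bexI[of _ "0\<^sub>v n"]) auto
qed

section \<open>The recursion satisfied by the Markov parameters\<close>

text \<open>The discrete Duhamel formula: expanding \<open>(A + D) ^ k\<close> according to the position of the
  leftmost factor \<open>D\<close>.\<close>

lemma perturbed_power_entry:
  fixes A :: "'a :: comm_semiring_1 mat"
  assumes C: "C \<in> carrier_mat p n" and A: "A \<in> carrier_mat n n" and D: "D \<in> carrier_mat n n"
    and G: "G \<in> carrier_mat n q" and ab: "a < p" "b < q"
  shows "(C * (A + D) ^\<^sub>m k * G) $$ (a, b) = (C * A ^\<^sub>m k * G) $$ (a, b) +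
    (\<Sum>i<k. (C * A ^\<^sub>m (k - 1 - i) * D * ((A + D) ^\<^sub>m i * G)) $$ (a, b))"
  using G
proof (induction k arbitrary: G)
  case 0
  then show ?case using A D by auto
next
  case (Suc k)
  let ?F = "A + D"
  have F: "?F \<in> carrier_mat n n" using A D by auto
  have FG: "?F * G \<in> carrier_mat n q" using F Suc.prems by auto
  have shift: "?F ^\<^sub>m i * (?F * G) = ?F ^\<^sub>m Suc i * G" for i
    using A D Suc.prems by (simp add: mult_assoc_dim)
  have "(C * ?F ^\<^sub>m Suc k * G) $$ (a, b) = (C * ?F ^\<^sub>m k * (?F * G)) $$ (a, b)"
    using A D C Suc.prems by (simp add: mult_assoc_dim)
  also have "\<dots> = (C * A ^\<^sub>m k * (?F * G)) $$ (a, b) +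
      (\<Sum>i<k. (C * A ^\<^sub>m (k - 1 - i) * D * (?F ^\<^sub>m Suc i * G)) $$ (a, b))"
    unfolding Suc.IH[OF FG] shift ..
  also have "C * A ^\<^sub>m k * (?F * G) = C * A ^\<^sub>m Suc k * G + C * A ^\<^sub>m k * D * G"
    using A C D Suc.prems
    by (simp add: mult_assoc_dim add_mult_distrib_dim mult_add_distrib_dim)
  also have "\<dots> $$ (a, b) = (C * A ^\<^sub>m Suc k * G) $$ (a, b) + (C * A ^\<^sub>m k * D * G) $$ (a, b)"
    using A C D Suc.prems ab by simp
  also have "\<dots> + (\<Sum>i<k. (C * A ^\<^sub>m (k - 1 - i) * D * (?F ^\<^sub>m Suc i * G)) $$ (a, b)) =
      (C * A ^\<^sub>m Suc k * G) $$ (a, b) +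
      (\<Sum>i<Suc k. (C * A ^\<^sub>m (Suc k - 1 - i) * D * (?F ^\<^sub>m i * G)) $$ (a, b))"
    using A D Suc.prems unfolding sum.lessThan_Suc_shift by (simp add: add.assoc)
  finally show ?case .
qed

lemma markov_carrier:
  assumes "A \<in> carrier_mat n n" "B \<in> carrier_mat n m" "C \<in> carrier_mat p n"
    "R \<in> carrier_mat m q" "Q \<in> carrier_mat m p"
  shows "markov A B C R Q k \<in> carrier_mat p q"
  using assms by (auto simp: markov_def)

lemma markov_recursion:
  assumes A: "A \<in> carrier_mat n n" and B: "B \<in> carrier_mat n m" and C: "C \<in> carrier_mat p n"
    and R: "R \<in> carrier_mat m q" and Q: "Q \<in> carrier_mat m p" and ab: "a < p" "b < q"
  shows "markov A B C R Q k $$ (a, b) = (C * A ^\<^sub>m k * B * R) $$ (a, b) +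
    (\<Sum>i<k. (C * A ^\<^sub>m (k - 1 - i) * B * Q * markov A B C R Q i) $$ (a, b))"
proof -
  have D: "B * Q * C \<in> carrier_mat n n" and BR: "B * R \<in> carrier_mat n q"
    using A B C R Q by auto
  have F: "A + B * Q * C \<in> carrier_mat n n" using A D by auto
  have M: "markov A B C R Q k = C * (A + B * Q * C) ^\<^sub>m k * (B * R)" for k
    unfolding markov_def using C F B R by (simp add: mult_assoc_dim)
  have forced: "C * A ^\<^sub>m j * (B * Q * C) * ((A + B * Q * C) ^\<^sub>m i * (B * R)) =
      C * A ^\<^sub>m j * B * Q * markov A B C R Q i" for i j
    unfolding M using A B C R Q F by (simp add: mult_assoc_dim)
  have free: "C * A ^\<^sub>m k * (B * R) = C * A ^\<^sub>m k * B * R"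
    using A B C R by (simp add: mult_assoc_dim)
  show ?thesis
    using perturbed_power_entry[OF C A D BR ab, of k] unfolding forced free M[symmetric] .
qed

text \<open>The recursion has \<open>C B R\<close> as its value at \<open>0\<close> and determines each parameter from the
  earlier ones, so a matrix \<open>X\<close> that satisfies it along the Markov parameters of \<open>Q\<close> reproduces
  them.\<close>

lemma markov_eq_if_recursion:
  assumes A: "A \<in> carrier_mat n n" and B: "B \<in> carrier_mat n m" and C: "C \<in> carrier_mat p n"
    and R: "R \<in> carrier_mat m q" and Q: "Q \<in> carrier_mat m p" and X: "X \<in> carrier_mat m p"
    and rec: "\<And>k a b. k \<le> r \<Longrightarrow> a < p \<Longrightarrow> b < q \<Longrightarrow>
      markov A B C R Q k $$ (a, b) = (C * A ^\<^sub>m k * B * R) $$ (a, b) +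
      (\<Sum>i<k. (C * A ^\<^sub>m (k - 1 - i) * B * X * markov A B C R Q i) $$ (a, b))"
  shows "k \<le> r \<Longrightarrow> markov A B C R Q k = markov A B C R X k"
proof (induction k rule: less_induct)
  case (less k)
  show ?case
  proof (rule eq_matI)
    fix a b
    assume "a < dim_row (markov A B C R X k)" "b < dim_col (markov A B C R X k)"
    then have ab: "a < p" "b < q"
      using markov_carrier[OF A B C R X, of k] by auto
    show "markov A B C R Q k $$ (a, b) = markov A B C R X k $$ (a, b)"
      unfolding rec[OF less.prems ab] markov_recursion[OF A B C R X ab, of k]
      using less.IH less.prems by simp
  qed (use markov_carrier[OF A B C R X, of k] markov_carrier[OF A B C R Q, of k] in auto)
qed

section \<open>The Sylvester equation, block row by block row\<close>

lemma block_index_less: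
  fixes k r h a :: nat
  assumes "k < r" "a < h"
  shows "k * h + a < r * h"
proof -
  have "k * h + a < Suc k * h" using assms by simp
  also have "\<dots> \<le> r * h" by (rule mult_le_mono1) (use assms in simp)
  finally show ?thesis .
qed

lemma vstack_Cons: "vstack nc (X # Xs) = X @\<^sub>r vstack nc Xs"
  by (simp add: vstack_def)

lemma hstack_Cons: "hstack nr (X # Xs) = append_cols X (hstack nr Xs)"
  by (simp add: hstack_def)

lemma vstack_uniform_carrier:
  assumes "set Xs \<subseteq> carrier_mat h nc"
  shows "vstack nc Xs \<in> carrier_mat (length Xs * h) nc"
  using assms by (induction Xs) (auto simp: vstack_def intro!: carrier_append_rows)

lemma hstack_uniform_carrier:
  assumes "set Xs \<subseteq> carrier_mat nr w"
  shows "hstack nr Xs \<in> carrier_mat nr (length Xs * w)"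
  using assms by (induction Xs) (auto simp: hstack_def append_cols_def)

lemma vstack_index:
  assumes "set Xs \<subseteq> carrier_mat h nc" "k < length Xs" "a < h" "b < nc"
  shows "vstack nc Xs $$ (k * h + a, b) = (Xs ! k) $$ (a, b)"
  using assms
proof (induction Xs arbitrary: k)
  case (Cons X Xs)
  have X: "X \<in> carrier_mat h nc" and Xs: "vstack nc Xs \<in> carrier_mat (length Xs * h) nc"
    using Cons.prems vstack_uniform_carrier by auto
  have "k * h + a < Suc (length Xs) * h"
    using Cons.prems by (intro block_index_less) auto
  then have lt: "k * h + a < h + length Xs * h" by simp
  show ?case
  proof (cases k)
    case 0
    then show ?thesis using X Xs Cons.prems lt by (simp add: vstack_Cons append_rows_def)
  next
    case (Suc l)
    then show ?thesis using X Xs Cons.prems lt Cons.IH[of l]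
      by (simp add: vstack_Cons append_rows_def add.assoc)
  qed
qed simp

lemma hstack_index:
  assumes "set Xs \<subseteq> carrier_mat nr w" "i < length Xs" "a < nr" "c < w"
  shows "hstack nr Xs $$ (a, i * w + c) = (Xs ! i) $$ (a, c)"
  using assms
proof (induction Xs arbitrary: i)
  case (Cons X Xs)
  have X: "X \<in> carrier_mat nr w" and Xs: "hstack nr Xs \<in> carrier_mat nr (length Xs * w)"
    using Cons.prems hstack_uniform_carrier by auto
  have "i * w + c < Suc (length Xs) * w"
    using Cons.prems by (intro block_index_less) auto
  then have lt: "i * w + c < w + length Xs * w" by simp
  show ?case
  proof (cases i)
    case 0
    then show ?thesis using X Xs Cons.prems lt by (simp add: hstack_Cons append_cols_def)
  next
    case (Suc l)
    then show ?thesis using X Xs Cons.prems lt Cons.IH[of l]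
      by (simp add: hstack_Cons append_cols_def add.assoc)
  qed
qed simp

definition toeplitz_block :: "real mat \<Rightarrow> real mat \<Rightarrow> real mat \<Rightarrow> nat \<Rightarrow> nat \<Rightarrow> real mat" where
  "toeplitz_block A B C k i =
    (if i \<le> k then C * A ^\<^sub>m (k - i) * B else 0\<^sub>m (dim_row C) (dim_col B))"

lemma toeplitz_block_carrier:
  assumes "A \<in> carrier_mat n n" "B \<in> carrier_mat n m" "C \<in> carrier_mat p n"
  shows "toeplitz_block A B C k i \<in> carrier_mat p m"
  using assms by (auto simp: toeplitz_block_def)

lemma toeplitz_row_carrier:
  assumes "A \<in> carrier_mat n n" "B \<in> carrier_mat n m" "C \<in> carrier_mat p n"
  shows "hstack p (map (toeplitz_block A B C k) [0..<r]) \<in> carrier_mat p (r * m)"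
proof -
  have "set (map (toeplitz_block A B C k) [0..<r]) \<subseteq> carrier_mat p m"
    using toeplitz_block_carrier[OF assms] by auto
  from hstack_uniform_carrier[OF this] show ?thesis by simp
qed

lemma L_mat_eq:
  assumes "B \<in> carrier_mat n m" "C \<in> carrier_mat p n"
  shows "L_mat A B C r =
    vstack (r * m) (map (\<lambda>k. hstack p (map (toeplitz_block A B C k) [0..<r])) [0..<r])"
  using assms by (simp add: L_mat_def toeplitz_block_def[abs_def])

lemma L_mat_carrier:
  assumes A: "A \<in> carrier_mat n n" and B: "B \<in> carrier_mat n m" and C: "C \<in> carrier_mat p n"
  shows "L_mat A B C r \<in> carrier_mat (r * p) (r * m)"
proof -
  have "set (map (\<lambda>k. hstack p (map (toeplitz_block A B C k) [0..<r])) [0..<r])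
      \<subseteq> carrier_mat p (r * m)"
    using toeplitz_row_carrier[OF A B C] by auto
  from vstack_uniform_carrier[OF this] show ?thesis
    by (simp add: L_mat_eq[OF B C])
qed

lemma L_block_carrier:
  assumes "A \<in> carrier_mat n n" "B \<in> carrier_mat n m" "C \<in> carrier_mat p n"
  shows "L_block A B C r i \<in> carrier_mat (r * p) m"
  using L_mat_carrier[OF assms, of r] assms(2) by (auto simp: L_block_def column_block_def)

lemma L_block_index:
  assumes A: "A \<in> carrier_mat n n" and B: "B \<in> carrier_mat n m" and C: "C \<in> carrier_mat p n"
    and k: "k < r" and i: "i < r" and a: "a < p" and c: "c < m"
  shows "L_block A B C r i $$ (k * p + a, c) =
    (if i \<le> k then (C * A ^\<^sub>m (k - i) * B) $$ (a, c) else 0)"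
proof -
  have "L_block A B C r i $$ (k * p + a, c) = L_mat A B C r $$ (k * p + a, i * m + c)"
    using L_mat_carrier[OF A B C, of r] block_index_less[OF k a] B c
    by (simp add: L_block_def column_block_def)
  also have "\<dots> = hstack p (map (toeplitz_block A B C k) [0..<r]) $$ (a, i * m + c)"
    unfolding L_mat_eq[OF B C]
    using toeplitz_row_carrier[OF A B C] k a block_index_less[OF i c]
    by (subst vstack_index) auto
  also have "\<dots> = toeplitz_block A B C k i $$ (a, c)"
    using toeplitz_block_carrier[OF A B C] i a c by (subst hstack_index) auto
  finally show ?thesis
    using a c B C by (simp add: toeplitz_block_def)
qed

lemma L_block_mult_index:
  assumes A: "A \<in> carrier_mat n n" and B: "B \<in> carrier_mat n m" and C: "C \<in> carrier_mat p n"
    and Y: "Y \<in> carrier_mat m q"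
    and k: "k < r" and i: "i < r" and a: "a < p" and b: "b < q"
  shows "(L_block A B C r i * Y) $$ (k * p + a, b) =
    (if i \<le> k then (C * A ^\<^sub>m (k - i) * B * Y) $$ (a, b) else 0)"
proof -
  have CAB: "C * A ^\<^sub>m (k - i) * B \<in> carrier_mat p m" using A B C by auto
  have "(L_block A B C r i * Y) $$ (k * p + a, b) =
      (\<Sum>c<m. (if i \<le> k then (C * A ^\<^sub>m (k - i) * B) $$ (a, c) else 0) * Y $$ (c, b))"
    using mult_mat_index[OF L_block_carrier[OF A B C] Y block_index_less[OF k a] b]
      L_block_index[OF A B C k i a] by simp
  then show ?thesis
    using mult_mat_index[OF CAB Y a b] by simp
qed

text \<open>Block row \<open>k\<close> of the equation, counted from \<open>0\<close>, is the recursion for the Markov parameter of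
  index \<open>k + 1\<close> with \<open>X\<close> in the place of \<open>Q\<close>: the stack \<open>K\<close> starts at index \<open>1\<close>, and the zero blocks
  of the Toeplitz matrix above its diagonal cut the sum off after \<open>i = k\<close>.\<close>

lemma sylvester_solution_iff_recursion:
  assumes A: "A \<in> carrier_mat n n" and B: "B \<in> carrier_mat n m" and C: "C \<in> carrier_mat p n"
    and R: "R \<in> carrier_mat m q" and Q: "Q \<in> carrier_mat m p" and X: "X \<in> carrier_mat m p"
  shows "sylvester_solution A B C R Q r X \<longleftrightarrow>
    (\<forall>k<r. \<forall>a<p. \<forall>b<q.
      markov A B C R Q (Suc k) $$ (a, b) = (C * A ^\<^sub>m Suc k * B * R) $$ (a, b) +
      (\<Sum>i<Suc k. (C * A ^\<^sub>m (k - i) * B * X * markov A B C R Q i) $$ (a, b)))"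
proof -
  let ?M = "markov A B C R Q"
  define rhs where "rhs = mat_sum (r * p) q (\<lambda>i. L_block A B C r i * X * ?M i) r"
  note M = markov_carrier[OF A B C R Q]
  have free: "C * A ^\<^sub>m k * B * R \<in> carrier_mat p q" for k
    using A B C R by auto
  have K: "K_block A B C R Q k \<in> carrier_mat p q" for k
    unfolding K_block_def using free by (rule minus_carrier_mat)
  have K_mat: "K_mat A B C R Q r \<in> carrier_mat (r * p) q"
  proof -
    have "set (map (K_block A B C R Q) [1..<Suc r]) \<subseteq> carrier_mat p q" using K by auto
    from vstack_uniform_carrier[OF this] show ?thesis
      using R by (simp add: K_mat_def del: upt_Suc)
  qed
  have K_index: "K_mat A B C R Q r $$ (k * p + a, b) =
      ?M (Suc k) $$ (a, b) - (C * A ^\<^sub>m Suc k * B * R) $$ (a, b)"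
    if "k < r" "a < p" "b < q" for k a b
  proof -
    have "K_mat A B C R Q r $$ (k * p + a, b) = K_block A B C R Q (Suc k) $$ (a, b)"
      unfolding K_mat_def using R K that
      by (subst vstack_index[where h = p]) (auto simp del: upt_Suc)
    then show ?thesis
      using that C R by (simp add: K_block_def del: pow_mat.simps)
  qed
  have rhs_index: "rhs $$ (k * p + a, b) =
      (\<Sum>i<Suc k. (C * A ^\<^sub>m (k - i) * B * X * ?M i) $$ (a, b))"
    if k: "k < r" and a: "a < p" and b: "b < q" for k a b
  proof -
    have XM: "X * ?M i \<in> carrier_mat m q" for i using X M by auto
    have L: "L_block A B C r i * X * ?M i = L_block A B C r i * (X * ?M i)" for i
      using L_block_carrier[OF A B C] X M by (intro assoc_mult_mat)
    have CAB: "C * A ^\<^sub>m j * B * X * ?M i = C * A ^\<^sub>m j * B * (X * ?M i)" for i j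
    proof -
      have "C * A ^\<^sub>m j * B \<in> carrier_mat p m" using A B C by auto
      then show ?thesis using X M by (rule assoc_mult_mat)
    qed
    have "rhs $$ (k * p + a, b) = (\<Sum>i<r. (L_block A B C r i * X * ?M i) $$ (k * p + a, b))"
      using block_index_less[OF k a] b by (simp add: rhs_def mat_sum_def)
    also have "\<dots> = (\<Sum>i<r. if i \<le> k then (C * A ^\<^sub>m (k - i) * B * X * ?M i) $$ (a, b) else 0)"
      unfolding L CAB by (rule sum.cong) (use L_block_mult_index[OF A B C XM k _ a b] in auto)
    also have "\<dots> = (\<Sum>i<Suc k. (C * A ^\<^sub>m (k - i) * B * X * ?M i) $$ (a, b))"
      using k by (intro sum.mono_neutral_cong_right) auto
    finally show ?thesis .
  qed
  \<comment> \<open>every row index of the stacked matrices is \<open>k * p + a\<close> for its quotient and remainder by \<open>p\<close>\<close>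
  have split: "K_mat A B C R Q r = rhs \<longleftrightarrow> (\<forall>k<r. \<forall>a<p. \<forall>b<q.
      K_mat A B C R Q r $$ (k * p + a, b) = rhs $$ (k * p + a, b))"
  proof (intro iffI eq_matI)
    fix e b
    assume eq: "\<forall>k<r. \<forall>a<p. \<forall>b<q. K_mat A B C R Q r $$ (k * p + a, b) = rhs $$ (k * p + a, b)"
      and "e < dim_row rhs" "b < dim_col rhs"
    then have e: "e < r * p" and b: "b < q" by (auto simp: rhs_def mat_sum_def)
    have "p > 0" using e by (cases p) auto
    then have "e div p < r" "e mod p < p"
      using e by (auto simp: less_mult_imp_div_less)
    then show "K_mat A B C R Q r $$ (e, b) = rhs $$ (e, b)"
      using eq[rule_format, of "e div p" "e mod p" b] b by simp
  qed (use K_mat in \<open>auto simp: rhs_def mat_sum_def\<close>)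
  have "sylvester_solution A B C R Q r X \<longleftrightarrow> K_mat A B C R Q r = rhs"
    using C R by (simp add: sylvester_solution_def rhs_def)
  then show ?thesis
    unfolding split
    by (simp add: K_index rhs_index diff_eq_eq add.commute[of "sum _ _"]
      del: pow_mat.simps sum.lessThan_Suc)
qed

section \<open>Sizes of block matrices assembled from a family of blocks\<close>

lemma sum_list_blocks:
  fixes d :: "nat \<Rightarrow> nat"
  assumes "\<And>i. i < N \<Longrightarrow> f (Xs i) = d i"
  shows "sum_list (map f (map Xs [0..<N])) = (\<Sum>i<N. d i)"
  using assms by (simp add: interv_sum_list_conv_sum_set_nat atLeast0LessThan)

lemma diag_blocks_carrier:
  assumes "\<And>i. i < N \<Longrightarrow> Xs i \<in> carrier_mat (h i) (w i)"
  shows "diag_block_mat (map Xs [0..<N]) \<in> carrier_mat (\<Sum>i<N. h i) (\<Sum>i<N. w i)"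
proof (rule carrier_matI)
  show "dim_row (diag_block_mat (map Xs [0..<N])) = (\<Sum>i<N. h i)"
    unfolding dim_diag_block_mat by (rule sum_list_blocks) (use assms in blast)
  show "dim_col (diag_block_mat (map Xs [0..<N])) = (\<Sum>i<N. w i)"
    unfolding dim_diag_block_mat by (rule sum_list_blocks) (use assms in blast)
qed

lemma vstack_blocks_carrier:
  assumes "\<And>i. i < N \<Longrightarrow> Xs i \<in> carrier_mat (h i) nc"
  shows "vstack nc (map Xs [0..<N]) \<in> carrier_mat (\<Sum>i<N. h i) nc"
proof -
  have "sum_list (map dim_row (map Xs [0..<N])) = (\<Sum>i<N. h i)"
    by (rule sum_list_blocks) (use assms in blast)
  moreover have "dim_col X = nc" if "X \<in> set (map Xs [0..<N])" for X
    using that assms by fastforce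
  ultimately show ?thesis
    using vstack_carrier[of "map Xs [0..<N]" nc] by simp
qed

lemma hstack_blocks_carrier:
  assumes "\<And>i. i < N \<Longrightarrow> Xs i \<in> carrier_mat nr (w i)"
  shows "hstack nr (map Xs [0..<N]) \<in> carrier_mat nr (\<Sum>i<N. w i)"
proof -
  have "sum_list (map dim_col (map Xs [0..<N])) = (\<Sum>i<N. w i)"
    by (rule sum_list_blocks) (use assms in blast)
  moreover have "dim_row X = nr" if "X \<in> set (map Xs [0..<N])" for X
    using that assms by fastforce
  ultimately show ?thesis
    using hstack_carrier[of "map Xs [0..<N]" nr] by simp
qed

section \<open>Identifiability from finitely many Markov parameters\<close>

text \<open>A solution has the Markov parameters of \<open>Q\<close> up to index \<open>r\<close>, hence all of them, and
  an identifiable topology admits no second matrix with these parameters.\<close>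

lemma interconnection_eq_if_sylvester_solution:
  assumes A: "A \<in> carrier_mat n n" and B: "B \<in> carrier_mat n m" and C: "C \<in> carrier_mat p n"
    and R: "R \<in> carrier_mat m q" and Q: "Q \<in> carrier_mat m p" and S: "S \<in> carrier_mat s p"
    and r: "2 * n \<le> Suc r"
    and ident: "identifiable A B C R S Q"
    and X: "X \<in> carrier_mat m p" and sol: "sylvester_solution A B C R Q r X"
  shows "X = Q"
proof -
  have rec: "markov A B C R Q k $$ (a, b) = (C * A ^\<^sub>m k * B * R) $$ (a, b) +
      (\<Sum>i<k. (C * A ^\<^sub>m (k - 1 - i) * B * X * markov A B C R Q i) $$ (a, b))"
    if "k \<le> r" "a < p" "b < q" for k a b
  proof (cases k)
    case 0
    then show ?thesis using A B C Q by (simp add: markov_def)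
  next
    case (Suc j)
    then show ?thesis
      using sol that unfolding sylvester_solution_iff_recursion[OF A B C R Q X]
      by (simp del: pow_mat.simps sum.lessThan_Suc)
  qed
  note initial = markov_eq_if_recursion[OF A B C R Q X rec]
  have F: "A + B * Q * C \<in> carrier_mat n n" "A + B * X * C \<in> carrier_mat n n"
    and BR: "B * R \<in> carrier_mat n q"
    using A B C Q X R by auto
  have M: "markov A B C R Y k = C * (A + B * Y * C) ^\<^sub>m k * (B * R)"
    if "A + B * Y * C \<in> carrier_mat n n" for Y k
    unfolding markov_def using C that B R by (simp add: mult_assoc_dim)
  have "markov A B C R Q k = markov A B C R X k" for k
    unfolding M[OF F(1)] M[OF F(2)]
  proof (rule markov_parameters_determined[OF C F(1) BR C F(2) BR])
    \<comment> \<open>\<open>2 * n \<le> r + 1\<close> puts all indices below \<open>2 * n\<close> into the range \<open>{0..r}\<close> covered by the equation\<close>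
    fix k assume "k < n + n"
    then show "C * (A + B * Q * C) ^\<^sub>m k * (B * R) = C * (A + B * X * C) ^\<^sub>m k * (B * R)"
      using initial[of k] r unfolding M[OF F(1)] M[OF F(2)] by simp
  qed
  then have "indistinguishable A B C R S Q X"
    by (rule indistinguishable_if_markov_eq[OF A B C R Q X S])
  then show ?thesis
    using ident Q X by (auto simp: identifiable_def)
qed

theorem theorem10:
  fixes N r n m p nu ny :: nat
    and ns ms ps :: "nat \<Rightarrow> nat"
    and As Bs Cs Rs Ss :: "nat \<Rightarrow> real mat"
    and Qs :: "nat \<Rightarrow> nat \<Rightarrow> real mat"
    and A B C Q R S :: "real mat"
  assumes "N \<ge> 1"
    and "\<And>i. i < N \<Longrightarrow> As i \<in> carrier_mat (ns i) (ns i)"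
    and "\<And>i. i < N \<Longrightarrow> Bs i \<in> carrier_mat (ns i) (ms i)"
    and "\<And>i. i < N \<Longrightarrow> Cs i \<in> carrier_mat (ps i) (ns i)"
    and "\<And>i j. i < N \<Longrightarrow> j < N \<Longrightarrow> Qs i j \<in> carrier_mat (ms i) (ps j)"
    and "\<And>i. i < N \<Longrightarrow> Rs i \<in> carrier_mat (ms i) nu"
    and "\<And>i. i < N \<Longrightarrow> Ss i \<in> carrier_mat ny (ps i)"
    and "n = (\<Sum>i<N. ns i)"
    and "m = (\<Sum>i<N. ms i)"
    and "p = (\<Sum>i<N. ps i)"
    and "A = diag_block_mat (map As [0..<N])"
    and "B = diag_block_mat (map Bs [0..<N])"
    and "C = diag_block_mat (map Cs [0..<N])"
    and "Q = vstack p (map (\<lambda>i. hstack (ms i) (map (\<lambda>j. Qs i j) [0..<N])) [0..<N])"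
    and "R = vstack nu (map Rs [0..<N])"
    and "S = hstack ny (map Ss [0..<N])"
    and "S = 1\<^sub>m ny"
    and "int r \<ge> 2 * int n - 1"
    and "identifiable A B C R S Q"
  shows "sylvester_solution A B C R Q r Q \<and>
    (\<forall>X \<in> carrier_mat m p. sylvester_solution A B C R Q r X \<longrightarrow> X = Q)"
proof -
  have A: "A \<in> carrier_mat n n" and B: "B \<in> carrier_mat n m" and C: "C \<in> carrier_mat p n"
    unfolding assms(8-13)
    by (rule diag_blocks_carrier, fact)+
  have R: "R \<in> carrier_mat m nu"
    unfolding assms(9,15) by (rule vstack_blocks_carrier) fact
  have S: "S \<in> carrier_mat ny p"
    unfolding assms(10,16) by (rule hstack_blocks_carrier) fact
  have "hstack (ms i) (map (Qs i) [0..<N]) \<in> carrier_mat (ms i) p" if "i < N" for i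
    unfolding assms(10) by (rule hstack_blocks_carrier) (rule assms(5)[OF that])
  then have Q: "Q \<in> carrier_mat m p"
    unfolding assms(9,14) by (rule vstack_blocks_carrier)
  have r: "2 * n \<le> Suc r" using assms(18) by linarith
  have "sylvester_solution A B C R Q r Q"
    unfolding sylvester_solution_iff_recursion[OF A B C R Q Q]
    using markov_recursion[OF A B C R Q] by (simp del: pow_mat.simps sum.lessThan_Suc)
  then show ?thesis
    using interconnection_eq_if_sylvester_solution[OF A B C R Q S r assms(19)] by blast
qed

end
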